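(* Let $\lambda\ge 0$, and for $t>0$ let $\alpha_n(t)$ and $\beta_n(t)$ be the recurrence coefficients of the monic orthogonal polynomials with respect to the weight $w(x;t)=x^{\lambda}e^{-x^2-t/x}$ on $(0,\infty)$. Then for every integer $n\ge 1$ and every $t>0$, with $'$ denoting $d/dt$ and all coefficients evaluated at $t$, $$t\,\alpha_n'(t)=\alpha_n+2\beta_n(\alpha_n+\alpha_{n-1})-2\beta_{n+1}(\alpha_n+\alpha_{n+1}),$$ $$t\,\beta_n'(t)=2\beta_n\big(\alpha_{n-1}^2-\alpha_n^2+\beta_{n-1}-\beta_{n+1}+1\big).$$
   Context: Let $w(x;t)=x^{\lambda}e^{-x^2-t/x}$ for $x\in(0,\infty)$, with $\lambda\ge 0$, $t>0$. Let $P_n(x;t)$, $n=0,1,2,\ldots$, be the monic polynomials with $\deg P_n=n$ satisfying $\int_0^\infty P_m(x;t)P_n(x;t)w(x;t)\,dx=h_n(t)\delta_{mn}$ for all $m,n\ge 0$. They satisfy the three-term recurrence relation $$xP_n(x;t)=P_{n+1}(x;t)+\alpha_n(t)P_n(x;t)+\beta_n(t)P_{n-1}(x;t),\qquad n\ge 0,$$ with $P_0(x;t)=1$ and $\beta_0(t)P_{-1}(x;t)=0$. This defines the recurrence coefficients $\alpha_n(t)$ ($n\ge0$) and $\beta_n(t)$ ($n\ge 1$, with $\beta_n=h_n/h_{n-1}$). The convention $\beta_0=0$ is used. *)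

theory Defs
  imports "HOL-Analysis.Analysis" "HOL-Computational_Algebra.Polynomial"
begin

definition weight :: "real \<Rightarrow> real \<Rightarrow> real \<Rightarrow> real" where
  "weight lam t x = x powr lam * exp (- (x ^ 2) - t / x)"

definition monic_orthogonal ::
  "(real \<Rightarrow> real) \<Rightarrow> (nat \<Rightarrow> real poly) \<Rightarrow> (nat \<Rightarrow> real) \<Rightarrow> bool" where
  "monic_orthogonal w P h \<longleftrightarrow>
     (\<forall>n. degree (P n) = n \<and> lead_coeff (P n) = 1) \<and>
     (\<forall>m n. (LBINT x:{0<..}. poly (P m) x * poly (P n) x * w x) = (if m = n then h n else 0))"

text \<open>For index 0 the term with \<open>P\<^sub>-\<^sub>1\<close> is absent, so the recurrence itself leaves
  \<open>b 0\<close> undetermined; its value is fixed separately by convention.\<close>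

definition recurrence_coeffs ::
  "(nat \<Rightarrow> real poly) \<Rightarrow> (nat \<Rightarrow> real) \<Rightarrow> (nat \<Rightarrow> real) \<Rightarrow> bool" where
  "recurrence_coeffs P a b \<longleftrightarrow>
     b 0 = 0 \<and>
     (\<forall>n. [:0, 1:] * P n =
        P (n + 1) + smult (a n) (P n) + (if n = 0 then 0 else smult (b n) (P (n - 1))))"

end

theory Submission
  imports Defs
begin

text \<open>
  Substituting \<open>x = t y\<close> turns the weight \<open>x powr a * exp (- x\<^sup>2 - t / x)\<close> into one whose dependence
  on \<open>t\<close> is Gaussian, and gives \<open>t m\<^sub>k' = (k + lam + 1) m\<^sub>k - 2 m\<^sub>k\<^sub>+\<^sub>2\<close> for the moments.
  Equivalently, with \<open>\<theta> = t d/dt + x d/dx\<close> acting on polynomials whose coefficients depend on \<open>t\<close>,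
  the functional \<open>L p = \<integral> p w\<close> satisfies \<open>t d/dt L p = L (\<theta> p + (lam + 1 - 2 x\<^sup>2) p)\<close>.
  Apply this to \<open>P\<^sub>n\<^sup>2\<close>, \<open>P\<^sub>n P\<^sub>n\<^sub>-\<^sub>1\<close> and \<open>x P\<^sub>n\<^sup>2\<close>. Since \<open>\<theta> P\<^sub>n\<close> is \<open>n P\<^sub>n\<close> plus
  terms of lower degree, orthogonality and the recurrence evaluate every term on the right, which gives
  the derivatives of \<open>h\<^sub>n\<close> and \<open>\<alpha>\<^sub>n h\<^sub>n\<close>, hence those of \<open>\<beta>\<^sub>n = h\<^sub>n / h\<^sub>n\<^sub>-\<^sub>1\<close> and \<open>\<alpha>\<^sub>n\<close>. The
  coefficients are differentiable by induction along the recurrence.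
\<close>

section \<open>Singular Gaussian integrals and their parameter derivatives\<close>

text \<open>Completing the square gives \<open>- s * x^2 <= 1 / (4 * s) - x\<close>, and
  \<open>c / x\<close> only lowers the exponent, so a multiple of the Gamma integrand with parameter
  \<open>a + 1\<close> dominates.\<close>

lemma set_integrable_powr_exp:
  fixes a s c :: real
  assumes "a > -1" "s > 0" "c \<ge> 0"
  shows "set_integrable lborel {0<..} (\<lambda>x. x powr a * exp (- s * x ^ 2 - c / x))"
proof -
  have "(\<lambda>x. x powr a / exp x) integrable_on {0..}"
    using Gamma_integral_real[of "a + 1"] assms(1) by (auto simp: integrable_on_def)
  then have "(\<lambda>x. x powr a / exp x) absolutely_integrable_on {0..}"
    by (subst absolutely_integrable_on_iff_nonneg) auto
  then have "set_integrable lebesgue {0<..} (\<lambda>x. x powr a / exp x)"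
    by (rule set_integrable_subset) auto
  then have gamma: "set_integrable lborel {0<..} (\<lambda>x. x powr a / exp x)"
    unfolding set_integrable_def by (subst (asm) integrable_completion) auto
  have "set_integrable lborel {0<..} (\<lambda>x. exp (1 / (4 * s)) * (x powr a / exp x))"
    by (rule set_integrable_mult_right[OF gamma])
  then show ?thesis
  proof (rule set_integrable_bound)
    show "set_borel_measurable lborel {0<..} (\<lambda>x. x powr a * exp (- s * x ^ 2 - c / x))"
      unfolding set_borel_measurable_def by measurable
    have "norm (x powr a * exp (- s * x ^ 2 - c / x))
        \<le> norm (exp (1 / (4 * s)) * (x powr a / exp x))" if "x > 0" for x
    proof -
      have "0 \<le> (2 * s * x - 1)^2 / (4 * s)" using assms by simp
      also have "\<dots> = s * x^2 - x + 1 / (4 * s)"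
        using assms by (simp add: power2_eq_square field_simps)
      finally have "- s * x ^ 2 - c / x \<le> 1 / (4 * s) - x"
        using that assms divide_nonneg_pos[of c x] by linarith
      then have "exp (- s * x ^ 2 - c / x) \<le> exp (1 / (4 * s)) / exp x"
        by (simp flip: exp_diff)
      from mult_left_mono[OF this, of "x powr a"] show ?thesis by (simp add: mult.commute)
    qed
    then show "AE x in lborel. x \<in> {0<..} \<longrightarrow> norm (x powr a * exp (- s * x ^ 2 - c / x))
        \<le> norm (exp (1 / (4 * s)) * (x powr a / exp x))" by simp
  qed
qed

text \<open>The weight has \<open>s = 1\<close>, \<open>c = t\<close>; after rescaling it has
  \<open>s = t^2\<close>, \<open>c = 1\<close>. Separate parameters allow differentiation in
  \<open>s\<close> alone.\<close>

definition powr_exp_integral :: "real \<Rightarrow> real \<Rightarrow> real \<Rightarrow> real" where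
  "powr_exp_integral a s c = (LBINT x:{0<..}. x powr a * exp (- s * x ^ 2 - c / x))"

lemma powr_exp_integral_rescale:
  assumes "t > 0"
  shows "powr_exp_integral a 1 t = t powr (a + 1) * powr_exp_integral a (t\<^sup>2) 1"
proof -
  have "powr_exp_integral a 1 t =
    (LBINT x. \<bar>t\<bar> *\<^sub>R (indicator {0<..} (0 + t * x) *\<^sub>R
        ((0 + t * x) powr a * exp (- 1 * (0 + t * x) ^ 2 - t / (0 + t * x)))))"
    unfolding powr_exp_integral_def set_lebesgue_integral_def
    by (subst lborel_integral_real_affine[where c = t and t = 0]) (use assms in auto)
  also have "\<dots> = (LBINT x. t powr (a + 1) * (indicator {0<..} x *\<^sub>R
        (x powr a * exp (- t\<^sup>2 * x ^ 2 - 1 / x))))"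
    by (rule Bochner_Integration.integral_cong)
      (use assms in \<open>auto simp: indicator_def powr_mult powr_add power_mult_distrib zero_less_mult_iff\<close>)
  finally show ?thesis
    by (simp add: powr_exp_integral_def set_lebesgue_integral_def)
qed

lemma abs_exp_minus_linear_le:
  fixes v :: real
  shows "\<bar>exp v - 1 - v\<bar> \<le> v\<^sup>2 * exp \<bar>v\<bar>"
proof -
  obtain u where u: "\<bar>u\<bar> \<le> \<bar>v\<bar>" "exp v = (\<Sum>m<2. v ^ m / fact m) + exp u / fact 2 * v ^ 2"
    using Maclaurin_exp_le[of v 2] by blast
  have "exp u * v\<^sup>2 \<le> exp \<bar>v\<bar> * v\<^sup>2"
    using u(1) by (intro mult_right_mono) auto
  moreover have "exp u * v\<^sup>2 \<ge> 0" by simp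
  ultimately show ?thesis using u(2) by (simp add: eval_nat_numeral algebra_simps abs_real_def)
qed

text \<open>Differentiation under the integral sign by an explicit estimate: with
  \<open>v = - d * x^2\<close>, the second-order remainder of \<open>exp v\<close> makes the error
  in the difference quotient at most \<open>\<bar>d\<bar> * C\<close>.\<close>

lemma DERIV_powr_exp_integral:
  assumes "a > -1" "s > 0" "c \<ge> 0"
  shows "((\<lambda>s. powr_exp_integral a s c) has_real_derivative - powr_exp_integral (a + 2) s c) (at s)"
proof -
  \<comment> \<open>The remainder factor \<open>v^2\<close> contributes \<open>d^2 * x^4\<close>,
    hence the exponent \<open>a + 4\<close>. For \<open>\<bar>d\<bar> < s / 2\<close> the factor
    \<open>exp \<bar>v\<bar>\<close> uses up at most half of the Gaussian decay, hence
    \<open>s / 2\<close>.\<close>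
  define C where "C = powr_exp_integral (a + 4) (s / 2) c"
  have bound: "\<bar>powr_exp_integral a (s + d) c - powr_exp_integral a s c + d * powr_exp_integral (a + 2) s c\<bar>
      \<le> d\<^sup>2 * C" if d: "\<bar>d\<bar> < s / 2" for d
  proof -
    let ?f = "\<lambda>a s x. x powr a * exp (- s * x ^ 2 - c / x)"
    have int: "set_integrable lborel {0<..} (?f a (s + d))" "set_integrable lborel {0<..} (?f a s)"
      "set_integrable lborel {0<..} (?f (a + 2) s)" "set_integrable lborel {0<..} (?f (a + 4) (s / 2))"
      by (rule set_integrable_powr_exp; use assms d in linarith)+
    have lhs_int: "set_integrable lborel {0<..} (\<lambda>x. ?f a (s + d) x - ?f a s x + d * ?f (a + 2) s x)"
      by (intro set_integral_add set_integral_diff set_integrable_mult_right int)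
    have eq: "powr_exp_integral a (s + d) c - powr_exp_integral a s c + d * powr_exp_integral (a + 2) s c
        = (LBINT x:{0<..}. ?f a (s + d) x - ?f a s x + d * ?f (a + 2) s x)"
      unfolding powr_exp_integral_def
      by (simp only: set_integral_diff(2)[OF int(1,2)] set_integral_mult_right
          set_integral_add(2)[OF set_integral_diff(1)[OF int(1,2)] set_integrable_mult_right[OF int(3)]])
    have "norm (LBINT x:{0<..}. ?f a (s + d) x - ?f a s x + d * ?f (a + 2) s x)
        \<le> (LBINT x:{0<..}. norm (?f a (s + d) x - ?f a s x + d * ?f (a + 2) s x))"
      by (rule set_integral_norm_bound[OF lhs_int])
    also have "\<dots> \<le> (LBINT x:{0<..}. d\<^sup>2 * ?f (a + 4) (s / 2) x)"
    proof (rule set_integral_mono)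
      show "set_integrable lborel {0<..} (\<lambda>x. norm (?f a (s + d) x - ?f a s x + d * ?f (a + 2) s x))"
        by (rule set_integrable_norm[OF lhs_int])
      show "set_integrable lborel {0<..} (\<lambda>x. d\<^sup>2 * ?f (a + 4) (s / 2) x)"
        by (intro set_integrable_mult_right int)
      fix x :: real assume "x \<in> {0<..}"
      then have x: "x > 0" by simp
      define v where "v = - d * x\<^sup>2"
      have p2: "x powr (a + 2) = x powr a * x^2" and p4: "x powr (a + 4) = x powr a * x^4"
        using x by (simp_all add: powr_add powr_numeral)
      have "?f a (s + d) x - ?f a s x + d * ?f (a + 2) s x = ?f a s x * (exp v - 1 - v)"
      proof -
        have "exp (- (s + d) * x ^ 2 - c / x) = exp (- s * x ^ 2 - c / x) * exp v"
          unfolding exp_add[symmetric] by (rule arg_cong[where f = exp]) (simp add: v_def algebra_simps)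
        then show ?thesis by (simp only: p2) (simp add: v_def algebra_simps)
      qed
      then have "norm (?f a (s + d) x - ?f a s x + d * ?f (a + 2) s x)
          = ?f a s x * \<bar>exp v - 1 - v\<bar>" by (simp add: abs_mult)
      also have "\<dots> \<le> ?f a s x * (v\<^sup>2 * exp \<bar>v\<bar>)"
        by (intro mult_left_mono abs_exp_minus_linear_le) simp
      also have "\<dots> \<le> ?f a s x * (v\<^sup>2 * exp (s / 2 * x\<^sup>2))"
      proof -
        have "\<bar>v\<bar> \<le> s / 2 * x\<^sup>2"
          using d mult_right_mono[of "\<bar>d\<bar>" "s / 2" "x\<^sup>2"] by (simp add: v_def abs_mult)
        then show ?thesis by (intro mult_left_mono) auto
      qed
      also have "\<dots> = d\<^sup>2 * (x powr a * x^4 * (exp (- s * x ^ 2 - c / x) * exp (s / 2 * x\<^sup>2)))"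
        by (simp add: v_def power_mult_distrib algebra_simps)
      also have "exp (- s * x ^ 2 - c / x) * exp (s / 2 * x\<^sup>2) = exp (- (s / 2) * x ^ 2 - c / x)"
        unfolding exp_add[symmetric] by (rule arg_cong[where f = exp]) (simp add: field_simps)
      finally show "norm (?f a (s + d) x - ?f a s x + d * ?f (a + 2) s x) \<le> d\<^sup>2 * ?f (a + 4) (s / 2) x"
        by (simp only: p4)
    qed
    also have "\<dots> = d\<^sup>2 * C" by (simp add: C_def powr_exp_integral_def)
    finally show ?thesis unfolding eq real_norm_def .
  qed
  have "\<forall>\<^sub>F d in at 0. \<bar>(powr_exp_integral a (s + d) c - powr_exp_integral a s c) / d + powr_exp_integral (a + 2) s c\<bar>
      \<le> \<bar>d\<bar> * C"
  proof (rule eventually_at_topological[THEN iffD2], intro exI conjI ballI impI)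
    show "open {- (s / 2)<..<s / 2}" "0 \<in> {- (s / 2)<..<s / 2}" using assms by auto
    fix d assume d: "d \<in> {- (s / 2)<..<s / 2}" "d \<noteq> 0"
    then have "\<bar>d\<bar> < s / 2" by auto
    from bound[OF this] have "\<bar>powr_exp_integral a (s + d) c - powr_exp_integral a s c + d * powr_exp_integral (a + 2) s c\<bar>
        \<le> \<bar>d\<bar> * (\<bar>d\<bar> * C)" by (simp add: power2_eq_square flip: mult.assoc)
    moreover have "(powr_exp_integral a (s + d) c - powr_exp_integral a s c) / d + powr_exp_integral (a + 2) s c
        = (powr_exp_integral a (s + d) c - powr_exp_integral a s c + d * powr_exp_integral (a + 2) s c) / d"
      using \<open>d \<noteq> 0\<close> by (simp add: field_simps)
    ultimately show "\<bar>(powr_exp_integral a (s + d) c - powr_exp_integral a s c) / d + powr_exp_integral (a + 2) s c\<bar>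
        \<le> \<bar>d\<bar> * C" using \<open>d \<noteq> 0\<close> by (simp add: abs_divide divide_le_eq mult.commute)
  qed
  moreover have "((\<lambda>d. \<bar>d\<bar> * C) \<longlongrightarrow> 0) (at 0)"
    by (auto intro!: tendsto_eq_intros)
  ultimately have "((\<lambda>d. (powr_exp_integral a (s + d) c - powr_exp_integral a s c) / d + powr_exp_integral (a + 2) s c) \<longlongrightarrow> 0) (at 0)"
    unfolding real_norm_def[symmetric] by (rule Lim_null_comparison)
  then show ?thesis
    unfolding DERIV_def by (subst LIM_zero_iff[symmetric]) simp
qed

text \<open>The rescaling moves the parameter off the singular term \<open>t / x\<close>, so that the
  derivative involves no negative powers of \<open>x\<close>.\<close>

lemma DERIV_powr_exp_integral_scaling:
  assumes "a > -1" "t > 0"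
  shows "((\<lambda>t. powr_exp_integral a 1 t) has_real_derivative
    ((a + 1) * powr_exp_integral a 1 t - 2 * powr_exp_integral (a + 2) 1 t) / t) (at t)"
proof -
  have "((\<lambda>t. powr_exp_integral a (t\<^sup>2) 1) has_real_derivative
      - powr_exp_integral (a + 2) (t\<^sup>2) 1 * (2 * t)) (at t)"
    by (rule DERIV_chain2[OF DERIV_powr_exp_integral])
      (use assms in \<open>auto intro!: derivative_eq_intros\<close>)
  moreover have "((\<lambda>t. t powr (a + 1)) has_real_derivative (a + 1) * t powr (a + 1 - 1)) (at t)"
    using assms(2) by (rule has_real_derivative_powr)
  ultimately have "((\<lambda>t. t powr (a + 1) * powr_exp_integral a (t\<^sup>2) 1) has_real_derivative
    t powr (a + 1) * (- powr_exp_integral (a + 2) (t\<^sup>2) 1 * (2 * t))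
      + (a + 1) * t powr (a + 1 - 1) * powr_exp_integral a (t\<^sup>2) 1) (at t)"
    by (intro DERIV_mult')
  moreover have "t powr (a + 1) * (- powr_exp_integral (a + 2) (t\<^sup>2) 1 * (2 * t))
      + (a + 1) * t powr (a + 1 - 1) * powr_exp_integral a (t\<^sup>2) 1
    = ((a + 1) * powr_exp_integral a 1 t - 2 * powr_exp_integral (a + 2) 1 t) / t"
  \<comment> \<open>The chain rule factor \<open>2 * t\<close> turns \<open>t powr (a + 1)\<close>
    into \<open>2 * t powr (a + 2)\<close>. Rescaling the integral with exponent
    \<open>a + 2\<close> produces \<open>t powr (a + 3)\<close>, one power more, whence the division
    by \<open>t\<close>.\<close>
  proof -
    have "t powr (a + 1) = t powr a * t" "t powr (a + 2 + 1) = t powr a * t * t * t"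
      using assms by (simp_all add: powr_add powr_numeral eval_nat_numeral)
    then show ?thesis
      using assms by (simp add: powr_exp_integral_rescale field_simps)
  qed
  ultimately have "((\<lambda>t. t powr (a + 1) * powr_exp_integral a (t\<^sup>2) 1) has_real_derivative
    ((a + 1) * powr_exp_integral a 1 t - 2 * powr_exp_integral (a + 2) 1 t) / t) (at t)"
    by simp
  then show ?thesis
    by (rule has_field_derivative_transform_within_open[where S = "{0<..}"])
      (use assms in \<open>auto simp: powr_exp_integral_rescale\<close>)
qed

section \<open>Moments and the moment functional\<close>

locale singular_gaussian_weight =
  fixes lam :: real
  assumes lam_nonneg: "lam \<ge> 0"
begin

definition moment :: "nat \<Rightarrow> real \<Rightarrow> real" where
  "moment i t = powr_exp_integral (real i + lam) 1 t"

definition L :: "real \<Rightarrow> real poly \<Rightarrow> real" where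
  "L t p = (LBINT x:{0<..}. poly p x * weight lam t x)"

lemma DERIV_moment:
  assumes "t > 0"
  shows "(moment i has_real_derivative
    ((real i + lam + 1) * moment i t - 2 * moment (i + 2) t) / t) (at t)"
  using DERIV_powr_exp_integral_scaling[of "real i + lam" t] assms lam_nonneg
  by (simp add: moment_def[abs_def] add_ac)

lemma monom_times_weight:
  assumes "x > 0"
  shows "x ^ i * weight lam t x = x powr (real i + lam) * exp (- 1 * x\<^sup>2 - t / x)"
  using assms by (simp add: weight_def powr_add powr_realpow)

lemma set_integrable_monom_weight:
  assumes "t > 0"
  shows "set_integrable lborel {0<..} (\<lambda>x. x ^ i * weight lam t x)"
proof -
  have "set_integrable lborel {0<..} (\<lambda>x. x powr (real i + lam) * exp (- 1 * x\<^sup>2 - t / x))"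
    by (rule set_integrable_powr_exp) (use assms lam_nonneg in auto)
  then show ?thesis
    by (subst set_integrable_cong[OF refl refl monom_times_weight]) auto
qed

lemma set_integrable_poly_weight:
  assumes "t > 0"
  shows "set_integrable lborel {0<..} (\<lambda>x. poly p x * weight lam t x)"
proof -
  have "integrable lborel (\<lambda>x. \<Sum>i\<le>degree p. coeff p i * (indicator {0<..} x *\<^sub>R (x ^ i * weight lam t x)))"
    using set_integrable_monom_weight[OF assms] unfolding set_integrable_def
    by (intro Bochner_Integration.integrable_sum integrable_mult_right)
  then show ?thesis
    by (simp add: set_integrable_def poly_altdef sum_distrib_left sum_distrib_right mult_ac)
qed

lemma L_add: "t > 0 \<Longrightarrow> L t (p + q) = L t p + L t q"
  by (simp add: L_def distrib_right set_integrable_poly_weight)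

lemma L_smult: "L t (smult c p) = c * L t p"
  by (simp add: L_def mult.assoc)

lemma L_0 [simp]: "L t 0 = 0"
  by (simp add: L_def)

lemma L_sum: "t > 0 \<Longrightarrow> L t (sum f A) = (\<Sum>i\<in>A. L t (f i))"
  by (induction A rule: infinite_finite_induct) (simp_all add: L_add)

lemma L_monom: "L t (monom c i) = c * moment i t"
proof -
  have "L t (monom c i) = c * (LBINT x:{0<..}. x ^ i * weight lam t x)"
    by (simp add: L_def poly_monom mult.assoc)
  also have "(LBINT x:{0<..}. x ^ i * weight lam t x) = moment i t"
    unfolding moment_def powr_exp_integral_def
    by (rule set_lebesgue_integral_cong) (use monom_times_weight in auto)
  finally show ?thesis .
qed

text \<open>A fixed limit \<open>N\<close> in place of \<open>degree p\<close> lets one finite sum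
  represent a whole family of polynomials, so that it can be differentiated termwise.\<close>

lemma L_eq_sum_moments:
  assumes "t > 0" "\<And>i. i > N \<Longrightarrow> coeff p i = 0"
  shows "L t p = (\<Sum>i\<le>N. coeff p i * moment i t)"
proof -
  have "degree p \<le> N" using assms(2) by (intro degree_le) auto
  then have "L t p = L t (\<Sum>i\<le>N. monom (coeff p i) i)"
    by (simp add: poly_as_sum_of_monoms')
  then show ?thesis using assms(1) by (simp add: L_sum L_monom)
qed

text \<open>If the integral vanished, almost every positive number would be a root of
  \<open>p\<close>, as the weight is positive there; but \<open>p\<close> has finitely many roots
  and \<open>{0<..<1}\<close> is not null.\<close>

lemma L_square_pos:
  assumes "t > 0" "p \<noteq> 0"
  shows "L t (p * p) > 0"
proof -
  let ?f = "\<lambda>x. indicator {0<..} x *\<^sub>R (poly (p * p) x * weight lam t x)"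
  have int: "integrable lborel ?f"
    using set_integrable_poly_weight[OF assms(1), of "p * p"] by (simp only: set_integrable_def)
  have nonneg: "?f x \<ge> 0" for x by (simp add: weight_def)
  have "L t (p * p) \<noteq> 0"
  proof
    assume "L t (p * p) = 0"
    then have "AE x in lborel. ?f x = 0"
      using integral_nonneg_eq_0_iff_AE[OF int] nonneg
      by (simp add: L_def set_lebesgue_integral_def)
    then have ae: "AE x in lborel. x > 0 \<longrightarrow> poly p x = 0"
      by eventually_elim (auto simp: weight_def)
    have "AE x in lborel. x \<notin> {x. poly p x = 0}"
      using poly_roots_finite[OF assms(2)]
      by (intro AE_not_in finite_imp_null_set_lborel)
    with ae have "AE x in lborel. x \<notin> {0<..<1::real}"
      by eventually_elim auto
    then have "emeasure lborel {0<..<1::real} = 0"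
      by (subst (asm) AE_iff_measurable[where N = "{0<..<1}"]) auto
    then show False by simp
  qed
  moreover have "L t (p * p) \<ge> 0"
    unfolding L_def set_lebesgue_integral_def by (rule Bochner_Integration.integral_nonneg) (rule nonneg)
  ultimately show ?thesis by simp
qed

end

section \<open>Polynomials with parameter-dependent coefficients\<close>

text \<open>All identities for the orthogonal polynomials hold for positive parameters only; this
  suffices for derivatives since that set is open.\<close>

lemma DERIV_cong_pos:
  fixes f g :: "real \<Rightarrow> real"
  assumes "(f has_real_derivative D) (at t)" "t > 0" "\<And>s. s > 0 \<Longrightarrow> f s = g s"
  shows "(g has_real_derivative D) (at t)"
  by (rule has_field_derivative_transform_within_open[OF assms(1) open_greaterThan[of 0]])
    (use assms in auto)

definition poly_X :: "real poly" where "poly_X = [:0, 1:]"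

lemma pderiv_X [simp]: "pderiv poly_X = 1"
  by (simp add: poly_X_def pderiv_pCons)

lemma X_mult_monom: "poly_X * monom c i = monom c (Suc i)"
  by (simp add: poly_X_def monom_Suc)

text \<open>Working coefficientwise avoids a topology on polynomials. The degree bound uniform in
  the parameter is a separate assumption of \<open>DERIV_L\<close>.\<close>

definition has_poly_derivative :: "(real \<Rightarrow> real poly) \<Rightarrow> real poly \<Rightarrow> real \<Rightarrow> bool" where
  "has_poly_derivative Q Q' t \<longleftrightarrow> (\<forall>i. ((\<lambda>s. coeff (Q s) i) has_real_derivative coeff Q' i) (at t))"

lemma has_poly_derivativeD:
  "has_poly_derivative Q Q' t \<Longrightarrow> ((\<lambda>s. coeff (Q s) i) has_real_derivative coeff Q' i) (at t)"
  by (simp add: has_poly_derivative_def)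

lemma has_poly_derivative_const: "has_poly_derivative (\<lambda>_. p) 0 t"
  by (simp add: has_poly_derivative_def)

lemma has_poly_derivative_diff:
  "has_poly_derivative A A' t \<Longrightarrow> has_poly_derivative B B' t
    \<Longrightarrow> has_poly_derivative (\<lambda>s. A s - B s) (A' - B') t"
  by (auto simp: has_poly_derivative_def intro!: derivative_intros)

lemma has_poly_derivative_mult:
  assumes "has_poly_derivative A A' t" "has_poly_derivative B B' t"
  shows "has_poly_derivative (\<lambda>s. A s * B s) (A t * B' + A' * B t) t"
  unfolding has_poly_derivative_def
proof
  fix n
  have "((\<lambda>s. \<Sum>i\<le>n. coeff (A s) i * coeff (B s) (n - i)) has_real_derivative
    (\<Sum>i\<le>n. coeff (A t) i * coeff B' (n - i) + coeff A' i * coeff (B t) (n - i))) (at t)"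
    by (intro DERIV_sum DERIV_mult' has_poly_derivativeD assms)
  then show "((\<lambda>s. coeff (A s * B s) n) has_real_derivative coeff (A t * B' + A' * B t) n) (at t)"
    by (simp add: coeff_mult sum.distrib)
qed

lemma has_poly_derivative_smult:
  assumes "(c has_real_derivative c') (at t)" "has_poly_derivative A A' t"
  shows "has_poly_derivative (\<lambda>s. smult (c s) (A s)) (smult (c t) A' + smult c' (A t)) t"
  using assms by (auto simp: has_poly_derivative_def intro!: DERIV_mult')

lemma has_poly_derivative_X_mult:
  "has_poly_derivative A A' t \<Longrightarrow> has_poly_derivative (\<lambda>s. poly_X * A s) (poly_X * A') t"
  using has_poly_derivative_mult[OF has_poly_derivative_const[of poly_X]] by simp

lemma has_poly_derivative_transform:
  assumes "has_poly_derivative A A' t" "t > 0" "\<And>s. s > 0 \<Longrightarrow> A s = B s"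
  shows "has_poly_derivative B A' t"
  unfolding has_poly_derivative_def
  using DERIV_cong_pos[OF has_poly_derivativeD[OF assms(1)] assms(2)] assms(3) by simp

text \<open>Applied with \<open>c = 1\<close> to the leading coefficient of a monic family, and with
  \<open>c = 0\<close> above the degree.\<close>

lemma has_poly_derivative_coeff_const:
  assumes "has_poly_derivative A A' t" "t > 0" "\<And>s. s > 0 \<Longrightarrow> coeff (A s) i = c"
  shows "coeff A' i = 0"
proof -
  have "((\<lambda>_. c) has_real_derivative coeff A' i) (at t)"
    using DERIV_cong_pos[OF has_poly_derivativeD[OF assms(1)] assms(2)] assms(3) by simp
  then show ?thesis using DERIV_const DERIV_unique by blast
qed

text \<open>The \<open>\<theta>\<close> above; \<open>p'\<close> stands for the coefficientwise derivative of \<open>p\<close> in \<open>t\<close>.\<close>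

definition euler_deriv :: "real \<Rightarrow> real poly \<Rightarrow> real poly \<Rightarrow> real poly" where
  "euler_deriv t p p' = smult t p' + poly_X * pderiv p"

lemma coeff_euler_deriv: "coeff (euler_deriv t p p') i = t * coeff p' i + real i * coeff p i"
  by (cases i) (simp_all add: euler_deriv_def poly_X_def coeff_pderiv)

text \<open>\<open>\<theta>\<close> is a derivation; the second argument on the left is the
  product-rule derivative from \<open>has_poly_derivative_mult\<close>.\<close>

lemma euler_deriv_mult:
  "euler_deriv t (p * q) (p * q' + p' * q) = p * euler_deriv t q q' + euler_deriv t p p' * q"
  by (simp add: euler_deriv_def pderiv_mult algebra_simps smult_add_right)

lemma euler_deriv_X_mult: "euler_deriv t (poly_X * p) (poly_X * p') = poly_X * p + poly_X * euler_deriv t p p'"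
  by (simp add: euler_deriv_def pderiv_mult algebra_simps)

section \<open>Differentiating the moment functional\<close>

context singular_gaussian_weight
begin

text \<open>Expand in moments: in \<open>DERIV_moment\<close> the factor \<open>real i\<close>
  becomes \<open>x d/dx\<close> on the polynomial, and the shift to \<open>moment (i + 2)\<close>
  becomes multiplication by \<open>x^2\<close>.\<close>

lemma DERIV_L:
  assumes t: "t > 0" and Q: "has_poly_derivative Q Q' t"
    and N: "\<And>s i. s > 0 \<Longrightarrow> i > N \<Longrightarrow> coeff (Q s) i = 0"
  shows "((\<lambda>s. L s (Q s)) has_real_derivative
    (L t (euler_deriv t (Q t) Q') + (lam + 1) * L t (Q t) - 2 * L t (poly_X * (poly_X * Q t))) / t) (at t)"
proof -
  have Q'0: "coeff Q' i = 0" if "i > N" for i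
    by (rule has_poly_derivative_coeff_const[OF Q t]) (use N that in auto)
  let ?q = "coeff (Q t)" and ?q' = "coeff Q'"
  let ?d = "\<lambda>i. ((real i + lam + 1) * moment i t - 2 * moment (i + 2) t) / t"
  have "((\<lambda>s. \<Sum>i\<le>N. coeff (Q s) i * moment i s) has_real_derivative
    (\<Sum>i\<le>N. ?q i * ?d i + ?q' i * moment i t)) (at t)"
    by (intro DERIV_sum DERIV_mult' has_poly_derivativeD Q DERIV_moment t)
  then have "((\<lambda>s. L s (Q s)) has_real_derivative (\<Sum>i\<le>N. ?q i * ?d i + ?q' i * moment i t)) (at t)"
    by (rule DERIV_cong_pos[OF _ t]) (intro L_eq_sum_moments[symmetric] N)
  moreover have "L t (poly_X * (poly_X * Q t)) = (\<Sum>i\<le>N. ?q i * moment (i + 2) t)"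
  proof -
    have "degree (Q t) \<le> N" using N t by (intro degree_le) auto
    then have "poly_X * (poly_X * Q t) = poly_X * (poly_X * (\<Sum>i\<le>N. monom (?q i) i))"
      by (simp only: poly_as_sum_of_monoms')
    also have "\<dots> = (\<Sum>i\<le>N. monom (?q i) (i + 2))"
      unfolding sum_distrib_left by (simp add: X_mult_monom)
    finally show ?thesis using t by (simp add: L_sum L_monom)
  qed
  moreover have "L t (euler_deriv t (Q t) Q') = (\<Sum>i\<le>N. (t * ?q' i + real i * ?q i) * moment i t)"
    by (subst L_eq_sum_moments[where N = N]) (use t Q'0 N in \<open>auto simp: coeff_euler_deriv\<close>)
  moreover have "L t (Q t) = (\<Sum>i\<le>N. ?q i * moment i t)"
    by (rule L_eq_sum_moments) (use t N in auto)
  moreover have "(\<Sum>i\<le>N. ?q i * ?d i + ?q' i * moment i t) =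
      ((\<Sum>i\<le>N. (t * ?q' i + real i * ?q i) * moment i t) + (lam + 1) * (\<Sum>i\<le>N. ?q i * moment i t)
        - 2 * (\<Sum>i\<le>N. ?q i * moment (i + 2) t)) / t"
    unfolding sum_distrib_left sum.distrib[symmetric] sum_subtractf[symmetric] sum_divide_distrib
    by (rule sum.cong) (use t in \<open>auto simp: field_simps\<close>)
  ultimately show ?thesis by simp
qed

text \<open>The factor \<open>x^2\<close> is split as one \<open>poly_X\<close> per polynomial, so
  that the recurrence applies to each.\<close>

lemma DERIV_L_mult:
  assumes t: "t > 0" and A: "has_poly_derivative A A' t" and B: "has_poly_derivative B B' t"
    and deg: "\<And>s. s > 0 \<Longrightarrow> degree (A s) \<le> M" "\<And>s. s > 0 \<Longrightarrow> degree (B s) \<le> N"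
  shows "((\<lambda>s. L s (A s * B s)) has_real_derivative
    (L t (A t * euler_deriv t (B t) B') + L t (euler_deriv t (A t) A' * B t)
      + (lam + 1) * L t (A t * B t) - 2 * L t ((poly_X * A t) * (poly_X * B t))) / t) (at t)"
proof -
  have "coeff (A s * B s) i = 0" if "s > 0" "i > M + N" for s i
    using degree_mult_le[of "A s" "B s"] deg[OF that(1)] that(2) by (intro coeff_eq_0) simp
  from DERIV_L[OF t has_poly_derivative_mult[OF A B] this] show ?thesis
    unfolding euler_deriv_mult L_add[OF t] by (simp only: mult_ac)
qed

end

section \<open>Consequences of orthogonality and the recurrence\<close>

locale orthogonal_recurrence = singular_gaussian_weight +
  fixes P :: "nat \<Rightarrow> real \<Rightarrow> real poly" and h \<alpha> \<beta> :: "nat \<Rightarrow> real \<Rightarrow> real"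
  assumes monic_orthogonal: "s > 0 \<Longrightarrow> monic_orthogonal (weight lam s) (\<lambda>k. P k s) (\<lambda>k. h k s)"
    and recurrence: "s > 0 \<Longrightarrow> recurrence_coeffs (\<lambda>k. P k s) (\<lambda>k. \<alpha> k s) (\<lambda>k. \<beta> k s)"
begin

lemma degree_P [simp]: "t > 0 \<Longrightarrow> degree (P n t) = n"
  using monic_orthogonal[of t] by (simp add: monic_orthogonal_def)

lemma coeff_P_top: "t > 0 \<Longrightarrow> coeff (P n t) n = 1"
  using monic_orthogonal[of t] by (auto simp: monic_orthogonal_def)

lemma coeff_P_above: "t > 0 \<Longrightarrow> i > n \<Longrightarrow> coeff (P n t) i = 0"
  by (simp add: coeff_eq_0)

lemma L_P_P: "t > 0 \<Longrightarrow> L t (P m t * P n t) = (if m = n then h n t else 0)"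
  using monic_orthogonal[of t] by (simp add: monic_orthogonal_def L_def)

lemma h_pos: "t > 0 \<Longrightarrow> h n t > 0"
  using L_square_pos[of t "P n t"] L_P_P[of t n n] coeff_P_top[of t n] by force

lemma \<beta>_0: "t > 0 \<Longrightarrow> \<beta> 0 t = 0"
  using recurrence[of t] by (simp add: recurrence_coeffs_def)

text \<open>At \<open>n = 0\<close> the truncated index \<open>n - 1\<close> is \<open>0\<close>,
  and \<open>\<beta> 0 t = 0\<close> removes the spurious term, so one formula covers all
  \<open>n\<close>.\<close>

lemma X_P:
  assumes "t > 0"
  shows "poly_X * P n t =
    P (Suc n) t + smult (\<alpha> n t) (P n t) + smult (\<beta> n t) (P (n - 1) t)"
proof -
  have "poly_X * P n t = P (n + 1) t + smult (\<alpha> n t) (P n t) +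
      (if n = 0 then 0 else smult (\<beta> n t) (P (n - 1) t))"
    using recurrence[OF assms] unfolding recurrence_coeffs_def poly_X_def by blast
  then show ?thesis by (simp add: \<beta>_0[OF assms])
qed

text \<open>Subtracting \<open>coeff q k\<close> times the monic \<open>P k\<close> lowers the
  degree bound by one, and the subtracted term is orthogonal to \<open>P n\<close> as
  \<open>k < n\<close>.\<close>

lemma L_P_mult_low:
  assumes t: "t > 0"
  shows "k \<le> n \<Longrightarrow> (\<And>i. i \<ge> k \<Longrightarrow> coeff q i = 0) \<Longrightarrow> L t (P n t * q) = 0"
proof (induction k arbitrary: q)
  case 0
  then have "q = 0" by (intro poly_eqI) simp
  then show ?case by simp
next
  case (Suc k)
  define r where "r = q - smult (coeff q k) (P k t)"
  have "coeff r i = 0" if "i \<ge> k" for i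
    using that Suc.prems(2)[of i] t by (cases "i = k") (auto simp: r_def coeff_P_top coeff_P_above)
  then have "L t (P n t * r) = 0" using Suc by simp
  moreover have "P n t * q = P n t * r + smult (coeff q k) (P n t * P k t)"
    by (simp add: r_def algebra_simps)
  ultimately show ?case using t Suc.prems(1) by (simp add: L_add L_smult L_P_P)
qed

lemma L_P_mult:
  assumes t: "t > 0" and q: "\<And>i. i > n \<Longrightarrow> coeff q i = 0"
  shows "L t (P n t * q) = coeff q n * h n t"
proof -
  define r where "r = q - smult (coeff q n) (P n t)"
  have "coeff r i = 0" if "i \<ge> n" for i
    using that q[of i] t by (cases "i = n") (auto simp: r_def coeff_P_top coeff_P_above)
  then have "L t (P n t * r) = 0" by (rule L_P_mult_low[OF t order_refl])
  moreover have "P n t * q = P n t * r + smult (coeff q n) (P n t * P n t)"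
    by (simp add: r_def algebra_simps)
  ultimately show ?thesis using t by (simp add: L_add L_smult L_P_P)
qed

lemma L_X_P_P:
  assumes "t > 0"
  shows "L t (poly_X * P n t * P n t) = \<alpha> n t * h n t"
    and "L t (poly_X * P (Suc n) t * P n t) = h (Suc n) t"
proof -
  show "L t (poly_X * P n t * P n t) = \<alpha> n t * h n t"
    unfolding X_P[OF assms] using assms
    by (cases n) (simp_all add: distrib_right L_add L_smult L_P_P \<beta>_0)
  have "poly_X * P (Suc n) t * P n t = P (Suc n) t * (poly_X * P n t)" by (simp only: mult_ac)
  also have "L t \<dots> = h (Suc n) t"
    unfolding X_P[OF assms] using assms
    by (simp add: distrib_left L_add L_smult L_P_P)
  finally show "L t (poly_X * P (Suc n) t * P n t) = h (Suc n) t" .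
qed

text \<open>The integral of \<open>x P\<^sub>n\<^sub>+\<^sub>1 P\<^sub>n\<close> is evaluated twice:
  \<open>L_X_P_P\<close> expands \<open>poly_X * P n\<close>, here \<open>poly_X * P (Suc n)\<close>
  is expanded.\<close>

lemma h_Suc:
  assumes "t > 0"
  shows "h (Suc n) t = \<beta> (Suc n) t * h n t"
proof -
  have "h (Suc n) t = L t (poly_X * P (Suc n) t * P n t)" using L_X_P_P(2)[OF assms] by simp
  also have "\<dots> = \<beta> (Suc n) t * h n t"
    unfolding X_P[OF assms] using assms by (simp add: distrib_right L_add L_smult L_P_P)
  finally show ?thesis .
qed

section \<open>Differentiability in the parameter\<close>

text \<open>Both are built from integrals of \<open>P n\<close>: \<open>h n\<close> is that of its
  square, and \<open>\<alpha> n\<close> is that of \<open>x\<close> times its square divided by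
  \<open>h n\<close>.\<close>

lemma has_poly_derivative_imp_DERIV_coeffs:
  assumes t: "t > 0" and P': "has_poly_derivative (P n) P' t"
  shows "\<exists>D. (h n has_real_derivative D) (at t)" "\<exists>D. (\<alpha> n has_real_derivative D) (at t)"
proof -
  obtain D where "((\<lambda>s. L s (P n s * P n s)) has_real_derivative D) (at t)"
    using DERIV_L_mult[OF t P' P', of n n] by auto
  then have h: "(h n has_real_derivative D) (at t)"
    by (rule DERIV_cong_pos[OF _ t]) (simp add: L_P_P)
  then show "\<exists>D. (h n has_real_derivative D) (at t)" by blast
  have "degree (poly_X * P n s) \<le> Suc n" if "s > 0" for s
    using degree_mult_le[of poly_X "P n s"] that by (simp add: poly_X_def)
  then obtain D' where "((\<lambda>s. L s (poly_X * P n s * P n s)) has_real_derivative D') (at t)"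
    using DERIV_L_mult[OF t has_poly_derivative_X_mult[OF P'] P', of "Suc n" n] by auto
  note DERIV_divide[OF this h]
  then have "((\<lambda>s. L s (poly_X * P n s * P n s) / h n s) has_real_derivative
      (D' * h n t - L t (poly_X * P n t * P n t) * D) / (h n t * h n t)) (at t)"
    using h_pos[OF t, of n] by simp
  then have "(\<alpha> n has_real_derivative
      (D' * h n t - L t (poly_X * P n t * P n t) * D) / (h n t * h n t)) (at t)"
    by (rule DERIV_cong_pos[OF _ t]) (use h_pos in \<open>simp add: L_X_P_P less_imp_neq[symmetric]\<close>)
  then show "\<exists>D. (\<alpha> n has_real_derivative D) (at t)" by blast
qed

lemma \<beta>_Suc: "t > 0 \<Longrightarrow> \<beta> (Suc n) t = h (Suc n) t / h n t"
  using h_pos[of t n] by (simp add: h_Suc)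

lemma DERIV_\<beta>_Suc:
  assumes t: "t > 0" and "(h n has_real_derivative D) (at t)"
    and "(h (Suc n) has_real_derivative D') (at t)"
  shows "(\<beta> (Suc n) has_real_derivative (D' * h n t - h (Suc n) t * D) / (h n t * h n t)) (at t)"
proof -
  have "h n t \<noteq> 0" using h_pos[OF t, of n] by simp
  from DERIV_divide[OF assms(3,2) this] show ?thesis
    by (rule DERIV_cong_pos[OF _ t]) (simp add: \<beta>_Suc)
qed

text \<open>The recurrence writes each polynomial through its two predecessors and their
  \<open>\<alpha>\<close> and \<open>\<beta>\<close>, which are differentiable once those
  predecessors are. \<open>P 1\<close> is separate because only \<open>\<beta> (Suc m)\<close> is a
  quotient of norms.\<close>

lemma P_differentiable:
  assumes t: "t > 0"
  shows "\<exists>P'. has_poly_derivative (P n) P' t"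
proof (induction n rule: less_induct)
  case (less n)
  consider "n = 0" | "n = 1" | m where "n = Suc (Suc m)"
    by (metis One_nat_def not0_implies_Suc)
  then show ?case
  proof cases
    case 1
    have "1 = P 0 s" if "s > 0" for s
      using degree_P[OF that, of 0] coeff_P_top[OF that, of 0] by (auto elim: degree_eq_zeroE)
    then have "has_poly_derivative (P 0) 0 t"
      by (rule has_poly_derivative_transform[OF has_poly_derivative_const[of 1] t])
    then show ?thesis using 1 by blast
  next
    case 2
    obtain P' where P': "has_poly_derivative (P 0) P' t" using less.IH[of 0] 2 by auto
    obtain a' where a': "(\<alpha> 0 has_real_derivative a') (at t)"
      using has_poly_derivative_imp_DERIV_coeffs(2)[OF t P'] by blast
    have "poly_X * P 0 s - smult (\<alpha> 0 s) (P 0 s) = P (Suc 0) s" if "s > 0" for s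
      using X_P[OF that, of 0] \<beta>_0[OF that] by simp
    from has_poly_derivative_transform[OF has_poly_derivative_diff[OF
            has_poly_derivative_X_mult[OF P'] has_poly_derivative_smult[OF a' P']] t this]
    show ?thesis unfolding 2 One_nat_def by (rule exI)
  next
    case (3 m)
    obtain P' where P': "has_poly_derivative (P (Suc m)) P' t" using less.IH[of "Suc m"] 3 by auto
    obtain P0' where P0': "has_poly_derivative (P m) P0' t" using less.IH[of m] 3 by auto
    obtain a' where a': "(\<alpha> (Suc m) has_real_derivative a') (at t)"
      using has_poly_derivative_imp_DERIV_coeffs(2)[OF t P'] by blast
    obtain h' where h': "(h (Suc m) has_real_derivative h') (at t)"
      using has_poly_derivative_imp_DERIV_coeffs(1)[OF t P'] by blast
    obtain h0' where h0': "(h m has_real_derivative h0') (at t)"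
      using has_poly_derivative_imp_DERIV_coeffs(1)[OF t P0'] by blast
    have "poly_X * P (Suc m) s - smult (\<alpha> (Suc m) s) (P (Suc m) s) - smult (\<beta> (Suc m) s) (P m s)
        = P (Suc (Suc m)) s" if "s > 0" for s
      by (simp add: X_P[OF that])
    from has_poly_derivative_transform[OF has_poly_derivative_diff[OF has_poly_derivative_diff[OF
            has_poly_derivative_X_mult[OF P'] has_poly_derivative_smult[OF a' P']]
            has_poly_derivative_smult[OF DERIV_\<beta>_Suc[OF t h0' h'] P0']] t this]
    show ?thesis unfolding 3 by (rule exI)
  qed
qed

text \<open>For \<open>t > 0\<close> the choice is unique, since real derivatives determine every
  coefficient.\<close>

definition P' :: "nat \<Rightarrow> real \<Rightarrow> real poly" where
  "P' n t = (SOME p'. has_poly_derivative (P n) p' t)"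

lemma has_poly_derivative_P: "t > 0 \<Longrightarrow> has_poly_derivative (P n) (P' n t) t"
  unfolding P'_def by (rule someI_ex[OF P_differentiable])

section \<open>Pairings evaluated by the recurrence\<close>

definition R :: "nat \<Rightarrow> real \<Rightarrow> real poly" where
  "R n t = euler_deriv t (P n t) (P' n t)"

text \<open>The leading coefficient is constant in \<open>t\<close>, so only \<open>x d/dx\<close>
  contributes.\<close>

lemma coeff_R_top:
  assumes t: "t > 0"
  shows "coeff (R n t) n = real n"
proof -
  have "coeff (P' n t) n = 0"
    using has_poly_derivative_coeff_const[OF has_poly_derivative_P[OF t] t coeff_P_top] .
  then show ?thesis using t by (simp add: R_def coeff_euler_deriv coeff_P_top)
qed

lemma coeff_R_above:
  assumes t: "t > 0" and i: "i > n"
  shows "coeff (R n t) i = 0"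
proof -
  have "coeff (P' n t) i = 0"
    using has_poly_derivative_coeff_const[OF has_poly_derivative_P[OF t] t coeff_P_above[OF _ i]] .
  then show ?thesis using t i by (simp add: R_def coeff_euler_deriv coeff_P_above)
qed

text \<open>These pairings see at most the top coefficient. Pairing \<open>P n\<close> with
  \<open>R (Suc n)\<close> involves a lower one and is left to \<open>L_P_R_Suc\<close>.\<close>

lemma L_P_R:
  assumes t: "t > 0"
  shows "L t (P n t * R n t) = real n * h n t" and "m < n \<Longrightarrow> L t (P n t * R m t) = 0"
  using L_P_mult[OF t, of n "R n t"] L_P_mult[OF t, of n "R m t"] coeff_R_above[OF t]
  by (simp_all add: coeff_R_top[OF t])

text \<open>Multiply the expansions of both factors; \<open>h_Suc\<close> turns \<beta>_n^2 h_(n-1)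
  into \<beta>_n h_n. The split on \<open>n\<close> isolates the truncated
  \<open>n - 1\<close>.\<close>

lemma L_XP_XP:
  assumes t: "t > 0"
  shows "L t (poly_X * P n t * (poly_X * P n t)) =
      h (Suc n) t + (\<alpha> n t)\<^sup>2 * h n t + \<beta> n t * h n t"
    and "L t (poly_X * P (Suc n) t * (poly_X * P n t)) = (\<alpha> (Suc n) t + \<alpha> n t) * h (Suc n) t"
proof -
  show "L t (poly_X * P n t * (poly_X * P n t)) =
      h (Suc n) t + (\<alpha> n t)\<^sup>2 * h n t + \<beta> n t * h n t"
    by (cases n) (simp_all add: X_P[OF t] t distrib_left distrib_right L_add L_smult L_P_P h_Suc \<beta>_0 power2_eq_square)
  show "L t (poly_X * P (Suc n) t * (poly_X * P n t)) = (\<alpha> (Suc n) t + \<alpha> n t) * h (Suc n) t"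
    by (cases n) (simp_all add: X_P[OF t] t distrib_left distrib_right L_add L_smult L_P_P h_Suc \<beta>_0)
qed

lemma L_X_P_P_Suc:
  assumes t: "t > 0"
  shows "L t (poly_X * P n t * P (Suc n) t) = h (Suc n) t"
  using L_X_P_P(2)[OF t, of n] by (simp add: mult_ac)

lemma L_X_P_P_far:
  assumes t: "t > 0"
  shows "L t (poly_X * P (Suc (Suc n)) t * P n t) = 0" "L t (poly_X * P n t * P (Suc (Suc n)) t) = 0"
  unfolding X_P[OF t] using t
  by (cases n; simp add: distrib_right L_add L_smult L_P_P)+

text \<open>This is the quadratic form of multiplication by \<open>x\<close>, tridiagonal in the
  orthogonal basis, at the coordinates \<open>1\<close>, \<open>\<alpha>\<close>,
  \<open>\<beta>\<close> of \<open>poly_X * P (Suc n) t\<close>; \<open>L_X_P_P_far\<close> supplies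
  the zero corners.\<close>

lemma L_X_XP_XP:
  assumes t: "t > 0"
  shows "L t (poly_X * (poly_X * P (Suc n) t) * (poly_X * P (Suc n) t)) =
    \<alpha> (n + 2) t * h (n + 2) t + 2 * \<alpha> (Suc n) t * h (n + 2) t + (\<alpha> (Suc n) t) ^ 3 * h (Suc n) t
      + 2 * \<beta> (Suc n) t * \<alpha> (Suc n) t * h (Suc n) t + (\<beta> (Suc n) t)\<^sup>2 * \<alpha> n t * h n t"
proof -
  have "poly_X * (poly_X * P (Suc n) t) = poly_X * P (Suc (Suc n)) t
      + smult (\<alpha> (Suc n) t) (poly_X * P (Suc n) t) + smult (\<beta> (Suc n) t) (poly_X * P n t)"
    by (subst X_P[OF t]) (simp add: algebra_simps)
  moreover have "L t ((poly_X * P (Suc (Suc n)) t + smult (\<alpha> (Suc n) t) (poly_X * P (Suc n) t) + smult (\<beta> (Suc n) t) (poly_X * P n t))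
     * (P (Suc (Suc n)) t + smult (\<alpha> (Suc n) t) (P (Suc n) t) + smult (\<beta> (Suc n) t) (P n t)))
    = \<alpha> (n + 2) t * h (n + 2) t + 2 * \<alpha> (Suc n) t * h (n + 2) t + (\<alpha> (Suc n) t) ^ 3 * h (Suc n) t
      + 2 * \<beta> (Suc n) t * \<alpha> (Suc n) t * h (Suc n) t + (\<beta> (Suc n) t)\<^sup>2 * \<alpha> n t * h n t"
    by (simp only: distrib_left distrib_right L_add[OF t] L_smult mult_smult_left mult_smult_right
        L_X_P_P[OF t] L_X_P_P_Suc[OF t] L_X_P_P_far[OF t])
      (simp add: power2_eq_square power3_eq_cube algebra_simps)
  moreover have "poly_X * P (Suc n) t =
      P (Suc (Suc n)) t + smult (\<alpha> (Suc n) t) (P (Suc n) t) + smult (\<beta> (Suc n) t) (P n t)"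
    by (subst X_P[OF t]) simp
  ultimately show ?thesis by (simp only:)
qed

section \<open>Derivatives of the norms and recurrence coefficients\<close>

text \<open>Differentiate the integral of the square of \<open>P n\<close>: each of the two
  \<open>\<theta>\<close> terms gives \<open>real n * h n t\<close>, and \<open>L_XP_XP\<close>
  evaluates the Gaussian term.\<close>

lemma DERIV_h:
  assumes t: "t > 0"
  shows "(h n has_real_derivative
    h n t * (2 * real n + lam + 1 - 2 * ((\<alpha> n t)\<^sup>2 + \<beta> n t + \<beta> (Suc n) t)) / t) (at t)"
proof -
  have "L t (R n t * P n t) = real n * h n t"
    using L_P_R(1)[OF t, of n] by (simp add: mult.commute)
  moreover note DERIV_L_mult[OF t has_poly_derivative_P[OF t, of n] has_poly_derivative_P[OF t, of n], of n n,
      folded R_def, unfolded L_P_R(1)[OF t] L_XP_XP(1)[OF t] L_P_P[OF t]]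
  ultimately have "((\<lambda>s. L s (P n s * P n s)) has_real_derivative
      (real n * h n t + real n * h n t + (lam + 1) * h n t
        - 2 * (h (Suc n) t + (\<alpha> n t)\<^sup>2 * h n t + \<beta> n t * h n t)) / t) (at t)"
    by simp
  also have "real n * h n t + real n * h n t + (lam + 1) * h n t
        - 2 * (h (Suc n) t + (\<alpha> n t)\<^sup>2 * h n t + \<beta> n t * h n t)
      = h n t * (2 * real n + lam + 1 - 2 * ((\<alpha> n t)\<^sup>2 + \<beta> n t + \<beta> (Suc n) t))"
    by (simp add: h_Suc[OF t] algebra_simps)
  finally show ?thesis
    by (rule DERIV_cong_pos[OF _ t]) (simp add: L_P_P)
qed

text \<open>Obtained by differentiating the orthogonality relation between \<open>P (Suc n)\<close> and \<open>P n\<close>.\<close>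

lemma L_P_R_Suc:
  assumes t: "t > 0"
  shows "L t (P n t * R (Suc n) t) = 2 * (\<alpha> (Suc n) t + \<alpha> n t) * h (Suc n) t"
proof -
  have "((\<lambda>s. L s (P (Suc n) s * P n s)) has_real_derivative
      (0 + L t (R (Suc n) t * P n t) + (lam + 1) * 0
        - 2 * ((\<alpha> (Suc n) t + \<alpha> n t) * h (Suc n) t)) / t) (at t)"
    using DERIV_L_mult[OF t has_poly_derivative_P[OF t, of "Suc n"] has_poly_derivative_P[OF t, of n], of "Suc n" n,
        folded R_def, unfolded L_P_R(2)[OF t lessI] L_XP_XP(2)[OF t] L_P_P[OF t]]
    by simp
  then have "((\<lambda>s. 0) has_real_derivative
      (0 + L t (R (Suc n) t * P n t) + (lam + 1) * 0
        - 2 * ((\<alpha> (Suc n) t + \<alpha> n t) * h (Suc n) t)) / t) (at t)"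
    by (rule DERIV_cong_pos[OF _ t]) (simp add: L_P_P)
  then have "(0 + L t (R (Suc n) t * P n t) + (lam + 1) * 0
        - 2 * ((\<alpha> (Suc n) t + \<alpha> n t) * h (Suc n) t)) / t = 0"
    by (rule DERIV_unique[OF _ DERIV_const])
  then show ?thesis using t by (simp add: mult.commute)
qed

text \<open>Logarithmic derivatives of consecutive norms are subtracted: \<open>lam + 1\<close> and
  the shared \<open>\<beta> (Suc n) t\<close> cancel, and the change of \<open>2 * real n\<close> by
  two leaves the summand \<open>1\<close>.\<close>

lemma DERIV_\<beta>:
  assumes t: "t > 0"
  shows "(\<beta> (Suc n) has_real_derivative
    2 * \<beta> (Suc n) t * ((\<alpha> n t)\<^sup>2 - (\<alpha> (Suc n) t)\<^sup>2 + \<beta> n t - \<beta> (n + 2) t + 1) / t) (at t)"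
proof -
  have "h n t \<noteq> 0" using h_pos[OF t, of n] by simp
  then show ?thesis
    using DERIV_\<beta>_Suc[OF t DERIV_h[OF t] DERIV_h[OF t], of n] t
    by (elim DERIV_cong) (simp add: h_Suc field_simps)
qed

lemma DERIV_\<alpha>:
  fixes n
  defines "N \<equiv> Suc n"
  assumes t: "t > 0"
  shows "(\<alpha> N has_real_derivative
    (\<alpha> N t + 2 * \<beta> N t * (\<alpha> N t + \<alpha> n t) - 2 * \<beta> (Suc N) t * (\<alpha> N t + \<alpha> (Suc N) t)) / t) (at t)"
proof -
  let ?A = "\<alpha> N t" and ?b = "\<beta> N t" and ?c = "\<beta> (Suc N) t" and ?h = "h N t"
  have h0: "?h \<noteq> 0" using h_pos[OF t, of N] by simp
  \<comment> \<open>Expanding \<open>poly_X * P N t\<close> pairs \<open>R N t\<close> with three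
    polynomials: the upper gives zero, the middle \<open>real N * ?h\<close>, and the lower is
    \<open>L_P_R_Suc\<close>.\<close>
  have LXR: "L t (poly_X * P N t * R N t) = real N * ?A * ?h + 2 * ?b * (?A + \<alpha> n t) * ?h"
  proof -
    have "L t (poly_X * P N t * R N t) = L t (P (Suc N) t * R N t) + ?A * L t (P N t * R N t) + ?b * L t (P n t * R N t)"
      unfolding X_P[OF t] by (simp add: N_def distrib_right L_add[OF t] L_smult)
    also have "\<dots> = real N * ?A * ?h + 2 * ?b * (?A + \<alpha> n t) * ?h"
      by (simp add: L_P_R[OF t] L_P_R_Suc[OF t] N_def)
    finally show ?thesis .
  qed
  have "euler_deriv t (poly_X * P N t) (poly_X * P' N t) * P N t = poly_X * P N t * P N t + poly_X * P N t * R N t"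
    by (simp add: euler_deriv_X_mult R_def algebra_simps)
  then have LRX: "L t (euler_deriv t (poly_X * P N t) (poly_X * P' N t) * P N t) =
      ?A * ?h + (real N * ?A * ?h + 2 * ?b * (?A + \<alpha> n t) * ?h)"
    by (simp add: L_add[OF t] L_X_P_P[OF t] LXR)
  have deg: "degree (poly_X * P N s) \<le> Suc N" if "s > 0" for s
    using degree_mult_le[of poly_X "P N s"] that by (simp add: poly_X_def)
  have cube: "L t (poly_X * (poly_X * P N t) * (poly_X * P N t)) =
      ?h * (\<alpha> (Suc N) t * ?c + 2 * ?A * ?c + ?A ^ 3 + 2 * ?b * ?A + ?b * \<alpha> n t)"
    using L_X_XP_XP[OF t, of n]
    by (simp add: N_def h_Suc[OF t] power2_eq_square algebra_simps)
  \<comment> \<open>\<open>E\<close> is \<open>t\<close> times the derivative of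
    \<open>\<alpha> N * h N\<close>, divided by \<open>?h\<close>. Its
    \<open>2 * real N + lam + 2\<close> exceeds the constant in \<open>DERIV_h\<close> by one,
    because \<open>\<theta>\<close> also acts on the factor \<open>x\<close>; that unit leaves the
    isolated \<open>?A\<close> in the result.\<close>
  define E where "E = ?A * ((2 * real N + lam + 2)) + 4 * ?b * (?A + \<alpha> n t)
      - 2 * (\<alpha> (Suc N) t * ?c + 2 * ?A * ?c + ?A ^ 3 + 2 * ?b * ?A + ?b * \<alpha> n t)"
  have "((\<lambda>s. L s (poly_X * P N s * P N s)) has_real_derivative (?h * E) / t) (at t)"
    using DERIV_L_mult[OF t has_poly_derivative_X_mult[OF has_poly_derivative_P[OF t, of N]]
        has_poly_derivative_P[OF t, of N] deg eq_refl[OF degree_P], folded R_def]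
    by (rule DERIV_cong) (simp_all add: LXR LRX L_X_P_P[OF t] cube, simp add: E_def algebra_simps)
  then have "((\<lambda>s. L s (poly_X * P N s * P N s) / h N s) has_real_derivative
      ((?h * E) / t * ?h - L t (poly_X * P N t * P N t) *
        (?h * (2 * real N + lam + 1 - 2 * (?A\<^sup>2 + ?b + ?c)) / t)) / (?h * ?h)) (at t)"
    by (rule DERIV_divide[OF _ DERIV_h[OF t] h0])
  then have "(\<alpha> N has_real_derivative
      ((?h * E) / t * ?h - L t (poly_X * P N t * P N t) *
        (?h * (2 * real N + lam + 1 - 2 * (?A\<^sup>2 + ?b + ?c)) / t)) / (?h * ?h)) (at t)"
    by (rule DERIV_cong_pos[OF _ t]) (use h_pos in \<open>simp add: L_X_P_P less_imp_neq[symmetric]\<close>)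
  moreover have "((?h * E) / t * ?h - L t (poly_X * P N t * P N t) *
        (?h * (2 * real N + lam + 1 - 2 * (?A\<^sup>2 + ?b + ?c)) / t)) / (?h * ?h)
      = (E - ?A * (2 * real N + lam + 1 - 2 * (?A\<^sup>2 + ?b + ?c))) / t"
    unfolding L_X_P_P(1)[OF t] using h0 t by (simp add: field_simps)
  moreover have "E - ?A * (2 * real N + lam + 1 - 2 * (?A\<^sup>2 + ?b + ?c)) =
      ?A + 2 * ?b * (?A + \<alpha> n t) - 2 * ?c * (?A + \<alpha> (Suc N) t)"
    by (simp add: E_def power2_eq_square power3_eq_cube algebra_simps)
  ultimately show ?thesis by simp
qed

end

theorem theorem2p2:
  fixes lam :: real
    and P :: "nat \<Rightarrow> real \<Rightarrow> real poly"
    and h \<alpha> \<beta> :: "nat \<Rightarrow> real \<Rightarrow> real"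
    and n :: nat and t :: real
  assumes "lam \<ge> 0"
    and "\<And>s. s > 0 \<Longrightarrow> monic_orthogonal (weight lam s) (\<lambda>k. P k s) (\<lambda>k. h k s)"
    and "\<And>s. s > 0 \<Longrightarrow> recurrence_coeffs (\<lambda>k. P k s) (\<lambda>k. \<alpha> k s) (\<lambda>k. \<beta> k s)"
    and "n \<ge> 1" and "t > 0"
  shows "(\<alpha> n) differentiable (at t) \<and> (\<beta> n) differentiable (at t) \<and>
    t * deriv (\<alpha> n) t =
      \<alpha> n t + 2 * \<beta> n t * (\<alpha> n t + \<alpha> (n - 1) t)
        - 2 * \<beta> (n + 1) t * (\<alpha> n t + \<alpha> (n + 1) t) \<and>
    t * deriv (\<beta> n) t =
      2 * \<beta> n t * ((\<alpha> (n - 1) t)^2 - (\<alpha> n t)^2 + \<beta> (n - 1) t - \<beta> (n + 1) t + 1)"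
proof -
  interpret orthogonal_recurrence lam P h \<alpha> \<beta>
    by unfold_locales (use assms in auto)
  obtain m where n: "n = Suc m" using assms(4) by (cases n) auto
  note D\<alpha> = DERIV_\<alpha>[OF assms(5), of m] and D\<beta> = DERIV_\<beta>[OF assms(5), of m]
  have "\<alpha> n differentiable (at t)" "\<beta> n differentiable (at t)"
    unfolding n real_differentiable_def using D\<alpha> D\<beta> by blast+
  then show ?thesis
    using DERIV_imp_deriv[OF D\<alpha>] DERIV_imp_deriv[OF D\<beta>] assms(5) by (simp add: n)
qed

end
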